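(* Let $({\bf c}_j)_{j\in J}$ be the finite family consisting of all the affine initial conditions $M_k$ ($0\le k\le k_{\max}$), upstream boundary conditions $\gamma_n$ and downstream boundary conditions $\beta_n$ ($0\le n\le n_{\max}$). Then the model constraints $${\bf M}_{{\bf c}_j}(t,x)\ \ge\ {\bf c}_i(t,x)\qquad\text{for all }(t,x)\in{\rm Dom}({\bf c}_i),\ \text{for all }(i,j)\in J^2,$$ are convex inequality constraints in the variable $$y=\big(\rho(0),\dots,\rho(k_{\max}),\,q_{\rm in}(0),\dots,q_{\rm in}(n_{\max}),\,q_{\rm out}(0),\dots,q_{\rm out}(n_{\max})\big);$$ that is, for every $(i,j)\in J^2$ and every $(t,x)\in{\rm Dom}({\bf c}_i)$, the corresponding constraint has the form $f(y)\le 0$, where $f={\bf c}_i(t,x)-{\bf M}_{{\bf c}_j}(t,x)$ is a convex function of $y$.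
   Context: Let $\xi<\chi$ be real numbers, $X>0$ a space step, $T>0$ a time step, and $k_{\max},n_{\max}$ nonnegative integers. Flux function: $\psi$ is the concave triangular function $\psi(\rho)=v\rho$ if $\rho\le\rho_c$ and $\psi(\rho)=w(\rho-\rho_m)$ otherwise, where $v>0>w$, $0<\rho_c<\rho_m$ and $v\rho_c=w(\rho_c-\rho_m)$; it is regarded as a function on $\mathbb{R}$. Its Legendre-Fenchel transform is $\varphi^*(u)=\sup_{p\in{\rm Dom}(\psi)}[\,p\,u+\psi(p)\,]$, and ${\rm Dom}(\varphi^* )$ is the set where it is finite, namely $[-v,-w]$, on which $\varphi^*(u)=\rho_c(u+v)$. Value conditions: given real coefficients $\rho(\cdot)$, $q_{\rm in}(\cdot)$, $q_{\rm out}(\cdot)$, set $M_k(t,x)=-\sum_{i=0}^{k-1}\rho(i)X-\rho(k)(x-kX)$ if $t=0$ and $x\in[kX,(k+1)X]$, and $+\infty$ otherwise; $\gamma_n(t,x)=\sum_{i=0}^{n-1}q_{\rm in}(i)T+q_{\rm in}(n)(t-nT)$ if $x=\xi$ and $t\in[nT,(n+1)T]$, and $+\infty$ otherwise; $\beta_n(t,x)=\sum_{i=0}^{n-1}q_{\rm out}(i)T+q_{\rm out}(n)(t-nT)-\sum_{k=0}^{k_{\max}}\rho(k)X$ if $x=\chi$ and $t\in[nT,(n+1)T]$, and $+\infty$ otherwise. ${\rm Dom}({\bf c})$ denotes the set of $(t,x)$ where ${\bf c}$ is finite (where the first case of its definition applies); it does not depend on the coefficients. Lax-Hopf solution: for a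 lower semicontinuous function ${\bf c}$ with values in $\mathbb{R}\cup\{+\infty\}$, the associated (Barron-Jensen/Frankowska) solution of the Hamilton-Jacobi equation $\partial_t{\bf M}-\psi(-\partial_x{\bf M})=0$ is $${\bf M}_{\bf c}(t,x)=\inf_{(u,S)\in{\rm Dom}(\varphi^* )\times\mathbb{R}_+}\big({\bf c}(t-S,x+Su)+S\,\varphi^*(u)\big),$$ where ${\bf c}=+\infty$ outside its domain. The value $+\infty$ is allowed for ${\bf M}_{{\bf c}_j}(t,x)$; in that case $f\equiv-\infty$, the constraint is vacuous, and $f$ is regarded as convex. *)

theory Defs
  imports "HOL-Analysis.Analysis" "HOL-Analysis.Finite_Function_Topology"
begin

definition triangular_flux :: "real \<Rightarrow> real \<Rightarrow> real \<Rightarrow> real \<Rightarrow> real \<Rightarrow> real" where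
  "triangular_flux v w \<rho>c \<rho>m \<rho> = (if \<rho> \<le> \<rho>c then v * \<rho> else w * (\<rho> - \<rho>m))"

definition legendre_fenchel :: "(real \<Rightarrow> real) \<Rightarrow> real \<Rightarrow> ereal" where
  "legendre_fenchel \<psi> u = (SUP p. ereal (p * u + \<psi> p))"

definition effective_domain :: "(real \<Rightarrow> ereal) \<Rightarrow> real set" where
  "effective_domain g = {u. \<bar>g u\<bar> \<noteq> \<infinity>}"

text \<open>
  The Lax-Hopf solution associated with a condition \<open>c\<close>, where \<open>c t x\<close> is \<open>\<infinity>\<close> off the
  domain of \<open>c\<close> (for \<open>t < 0\<close> in particular).
\<close>

definition lax_hopf :: "(real \<Rightarrow> real) \<Rightarrow> (real \<Rightarrow> real \<Rightarrow> ereal) \<Rightarrow> real \<Rightarrow> real \<Rightarrow> ereal" where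
  "lax_hopf \<psi> c t x =
     (INF (u, S) \<in> effective_domain (legendre_fenchel \<psi>) \<times> {0..}.
        c (t - S) (x + S * u) + ereal S * legendre_fenchel \<psi> u)"

datatype coeff = Rho nat | Qin nat | Qout nat

definition coeffs :: "nat \<Rightarrow> nat \<Rightarrow> coeff set" where
  "coeffs kmax nmax = Rho ` {..kmax} \<union> Qin ` {..nmax} \<union> Qout ` {..nmax}"

text \<open>
  The decision variable \<open>y\<close> ranges over the space of real vectors whose coordinates are indexed
  by the finite set \<open>coeffs kmax nmax\<close>. As its dimension \<open>(kmax + 1) + 2 * (nmax + 1)\<close> depends
  on the parameters, it is realised as a linear subspace of the finitely supported functions on
  \<^typ>\<open>coeff\<close>.
\<close>

definition decision_space :: "nat \<Rightarrow> nat \<Rightarrow> (coeff \<Rightarrow>\<^sub>0 real) set" where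
  "decision_space kmax nmax = {y. Poly_Mapping.keys y \<subseteq> coeffs kmax nmax}"

abbreviation rho :: "(coeff \<Rightarrow>\<^sub>0 real) \<Rightarrow> nat \<Rightarrow> real" where
  "rho y k \<equiv> Poly_Mapping.lookup y (Rho k)"

abbreviation qin :: "(coeff \<Rightarrow>\<^sub>0 real) \<Rightarrow> nat \<Rightarrow> real" where
  "qin y n \<equiv> Poly_Mapping.lookup y (Qin n)"

abbreviation qout :: "(coeff \<Rightarrow>\<^sub>0 real) \<Rightarrow> nat \<Rightarrow> real" where
  "qout y n \<equiv> Poly_Mapping.lookup y (Qout n)"

text \<open>
  The conditions \<open>M\<^sub>k\<close>, \<open>\<gamma>\<^sub>n\<close> and \<open>\<beta>\<^sub>n\<close> are named \<open>Initial k\<close>, \<open>Upstream n\<close> and \<open>Downstream n\<close>.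
\<close>

datatype cond = Initial nat | Upstream nat | Downstream nat

definition conds :: "nat \<Rightarrow> nat \<Rightarrow> cond set" where
  "conds kmax nmax = Initial ` {..kmax} \<union> Upstream ` {..nmax} \<union> Downstream ` {..nmax}"

fun cond_dom :: "real \<Rightarrow> real \<Rightarrow> real \<Rightarrow> real \<Rightarrow> cond \<Rightarrow> (real \<times> real) set" where
  "cond_dom xi chi X T (Initial k) = {0} \<times> {real k * X .. (real k + 1) * X}"
| "cond_dom xi chi X T (Upstream n) = {real n * T .. (real n + 1) * T} \<times> {xi}"
| "cond_dom xi chi X T (Downstream n) = {real n * T .. (real n + 1) * T} \<times> {chi}"

fun cond_formula :: "real \<Rightarrow> real \<Rightarrow> nat \<Rightarrow> (coeff \<Rightarrow>\<^sub>0 real) \<Rightarrow> cond \<Rightarrow> real \<Rightarrow> real \<Rightarrow> real" where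
  "cond_formula X T kmax y (Initial k) t x =
     - (\<Sum>i<k. rho y i * X) - rho y k * (x - real k * X)"
| "cond_formula X T kmax y (Upstream n) t x =
     (\<Sum>i<n. qin y i * T) + qin y n * (t - real n * T)"
| "cond_formula X T kmax y (Downstream n) t x =
     (\<Sum>i<n. qout y i * T) + qout y n * (t - real n * T) - (\<Sum>k\<le>kmax. rho y k * X)"

definition value_cond ::
  "real \<Rightarrow> real \<Rightarrow> real \<Rightarrow> real \<Rightarrow> nat \<Rightarrow> (coeff \<Rightarrow>\<^sub>0 real) \<Rightarrow> cond \<Rightarrow> real \<Rightarrow> real \<Rightarrow> ereal" where
  "value_cond xi chi X T kmax y c t x =
     (if (t, x) \<in> cond_dom xi chi X T c then ereal (cond_formula X T kmax y c t x) else \<infinity>)"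

lemma cond_dom_eq_finite:
  "cond_dom xi chi X T c = {(t, x). \<bar>value_cond xi chi X T kmax y c t x\<bar> \<noteq> \<infinity>}"
  by (auto simp: value_cond_def split: if_splits)

text \<open>
  Besides real-valued convex functions, only the function that is constantly \<open>-\<infinity>\<close> counts as
  convex: a function with both finite and infinite values on \<open>Y\<close> is excluded.
\<close>

definition convex_ereal_on :: "'a::real_vector set \<Rightarrow> ('a \<Rightarrow> ereal) \<Rightarrow> bool" where
  "convex_ereal_on Y f \<longleftrightarrow>
     (\<forall>y\<in>Y. f y = - \<infinity>) \<or> (\<exists>g. (\<forall>y\<in>Y. f y = ereal (g y)) \<and> convex_on Y g)"

end

theory Submission
  imports Defs
begin

text \<open>
  The set of pairs \<open>(u, S)\<close> for which \<open>(t - S, x + S * u)\<close> lies in the domain of a condition does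
  not depend on the coefficients. If it is empty, the Lax-Hopf value is \<open>\<infinity>\<close>. Otherwise
  that value is an infimum of functions affine in the coefficients; it is finite because the
  condition is bounded on its compact domain and the Legendre-Fenchel transform is nonnegative
  (as \<open>\<psi> 0 = 0\<close>). So it is concave, and the condition it is subtracted from is affine.
\<close>

text \<open>Concavity bounds each \<open>h s\<close> at the combined point from below by the
  combination of its values, hence by that of the two infima. \<open>bdd\<close> makes those real
  infima genuine lower bounds of their families.\<close>

lemma concave_on_INF:
  fixes h :: "'i \<Rightarrow> 'a::real_vector \<Rightarrow> real"
  assumes ne: "F \<noteq> {}"
    and conc: "\<And>s. s \<in> F \<Longrightarrow> concave_on Y (h s)"
    and bdd: "\<And>y. y \<in> Y \<Longrightarrow> bdd_below ((\<lambda>s. h s y) ` F)"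
  shows "concave_on Y (\<lambda>y. INF s\<in>F. h s y)"
  unfolding concave_on_iff
proof (intro conjI ballI allI impI)
  show "convex Y"
    using ne conc concave_on_imp_convex by blast
next
  fix y z and a b :: real
  assume y: "y \<in> Y" and z: "z \<in> Y" and ab: "0 \<le> a" "0 \<le> b" "a + b = 1"
  show "(INF s\<in>F. h s (a *\<^sub>R y + b *\<^sub>R z)) \<ge> a * (INF s\<in>F. h s y) + b * (INF s\<in>F. h s z)"
  proof (rule cINF_greatest[OF ne])
    fix s assume s: "s \<in> F"
    have "a * (INF s\<in>F. h s y) + b * (INF s\<in>F. h s z) \<le> a * h s y + b * h s z"
      using ab s y z by (intro add_mono mult_left_mono cINF_lower bdd) auto
    also have "\<dots> \<le> h s (a *\<^sub>R y + b *\<^sub>R z)"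
      using conc[OF s] y z ab by (auto simp: concave_on_iff)
    finally show "a * (INF s\<in>F. h s y) + b * (INF s\<in>F. h s z) \<le> h s (a *\<^sub>R y + b *\<^sub>R z)" .
  qed
qed

text \<open>Scaling is defined through \<open>Abs_poly_mapping\<close>, so it acts coordinatewise
  once the scaled function is known to have finite support; that support lies inside the support of
  \<open>y\<close>.\<close>

lemma lookup_scaleR [simp]: "Poly_Mapping.lookup (r *\<^sub>R y) i = r *\<^sub>R Poly_Mapping.lookup y i"
proof -
  have "finite {i. r *\<^sub>R Poly_Mapping.lookup y i \<noteq> 0}"
    by (rule finite_subset[OF _ finite_lookup[of y]]) auto
  then show ?thesis
    by (simp add: scaleR_poly_mapping_def lookup_Abs_poly_mapping)
qed

lemma convex_decision_space: "convex (decision_space kmax nmax)"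
proof -
  have "decision_space kmax nmax = {y. \<forall>i. i \<notin> coeffs kmax nmax \<longrightarrow> Poly_Mapping.lookup y i = 0}"
    unfolding decision_space_def subset_iff in_keys_iff by blast
  then show ?thesis
    by (simp add: convex_def lookup_add)
qed

lemma cond_formula_combination:
  "cond_formula X T kmax (a *\<^sub>R y + b *\<^sub>R z) c t x =
   a * cond_formula X T kmax y c t x + b * cond_formula X T kmax z c t x"
  by (cases c) (simp_all add: lookup_add sum.distrib sum_distrib_left algebra_simps)

lemma bdd_below_cond_formula:
  "bdd_below ((\<lambda>(t, x). cond_formula X T kmax y c t x) ` cond_dom xi chi X T c)"
proof -
  have "compact (cond_dom xi chi X T c)"
    by (cases c) (auto intro: compact_Times)
  moreover have "continuous_on (cond_dom xi chi X T c) (\<lambda>(t, x). cond_formula X T kmax y c t x)"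
    by (cases c) (auto simp: case_prod_unfold intro!: continuous_intros)
  ultimately show ?thesis
    by (intro bounded_imp_bdd_below compact_imp_bounded compact_continuous_image)
qed

text \<open>The supremum contains the term for \<open>p = 0\<close>, which equals
  \<open>\<psi> 0\<close> whatever \<open>u\<close> is.\<close>

lemma legendre_fenchel_nonneg:
  assumes "\<psi> 0 = 0"
  shows "legendre_fenchel \<psi> u \<ge> 0"
proof -
  have "ereal (0 * u + \<psi> 0) \<le> legendre_fenchel \<psi> u"
    unfolding legendre_fenchel_def by (rule SUP_upper) simp
  then show ?thesis
    using assms by (simp add: zero_ereal_def)
qed

definition feasible ::
  "(real \<Rightarrow> real) \<Rightarrow> real \<Rightarrow> real \<Rightarrow> real \<Rightarrow> real \<Rightarrow> cond \<Rightarrow> real \<Rightarrow> real \<Rightarrow> (real \<times> real) set" where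
  "feasible \<psi> xi chi X T c t x =
     {(u, S) \<in> effective_domain (legendre_fenchel \<psi>) \<times> {0..}. (t - S, x + S * u) \<in> cond_dom xi chi X T c}"

text \<open>The Lax-Hopf objective as a real number. Taking \<open>real_of_ereal\<close> loses
  nothing on \<open>feasible\<close> pairs, where \<open>u\<close> lies in the effective
  domain.\<close>

definition path_cost ::
  "(real \<Rightarrow> real) \<Rightarrow> real \<Rightarrow> real \<Rightarrow> nat \<Rightarrow> cond \<Rightarrow> real \<Rightarrow> real \<Rightarrow> real \<times> real \<Rightarrow> (coeff \<Rightarrow>\<^sub>0 real) \<Rightarrow> real" where
  "path_cost \<psi> X T kmax c t x = (\<lambda>(u, S) y.
     cond_formula X T kmax y c (t - S) (x + S * u) + S * real_of_ereal (legendre_fenchel \<psi> u))"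

lemma lax_hopf_value_cond:
  "lax_hopf \<psi> (value_cond xi chi X T kmax y c) t x =
     (INF s\<in>feasible \<psi> xi chi X T c t x. ereal (path_cost \<psi> X T kmax c t x s y))"
proof -
  let ?cost = "\<lambda>(u, S). value_cond xi chi X T kmax y c (t - S) (x + S * u) +
    ereal S * legendre_fenchel \<psi> u"
  let ?D = "effective_domain (legendre_fenchel \<psi>) \<times> {0..}"
  let ?F = "feasible \<psi> xi chi X T c t x"
  have on: "?cost s = ereal (path_cost \<psi> X T kmax c t x s y)" if "s \<in> ?F" for s
    using that by (auto simp: feasible_def effective_domain_def path_cost_def value_cond_def
        simp flip: ereal_real')
  \<comment> \<open>The transform is finite on \<open>?D\<close>, so it cannot cancel the infinite
    value of the condition; such pairs leave the infimum unchanged.\<close>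
  have off: "?cost s = \<infinity>" if "s \<in> ?D" "s \<notin> ?F" for s
    using that by (auto simp: feasible_def effective_domain_def value_cond_def split: if_splits)
  have "(INF s\<in>?D. ?cost s) = (INF s\<in>?F. ?cost s)"
  proof (rule antisym)
    show "(INF s\<in>?D. ?cost s) \<le> (INF s\<in>?F. ?cost s)"
      by (rule INF_superset_mono) (auto simp: feasible_def)
    show "(INF s\<in>?F. ?cost s) \<le> (INF s\<in>?D. ?cost s)"
    proof (rule INF_greatest)
      fix s :: "real \<times> real" assume "s \<in> ?D"
      then show "(INF s\<in>?F. ?cost s) \<le> ?cost s"
        using off[of s] by (cases "s \<in> ?F") (simp_all add: INF_lower)
    qed
  qed
  then show ?thesis
    using on by (simp add: lax_hopf_def)
qed

lemma bdd_below_path_cost: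
  assumes "\<psi> 0 = 0"
  shows "bdd_below ((\<lambda>s. path_cost \<psi> X T kmax c t x s y) ` feasible \<psi> xi chi X T c t x)"
proof -
  \<comment> \<open>This \<open>m\<close> bounds the formula on its whole domain, hence uniformly
    over all feasible pairs.\<close>
  obtain m where m: "\<And>t x. (t, x) \<in> cond_dom xi chi X T c \<Longrightarrow> m \<le> cond_formula X T kmax y c t x"
    using bdd_below_cond_formula[of X T kmax y c xi chi] by (fastforce simp: bdd_below_def)
  have "m \<le> path_cost \<psi> X T kmax c t x (u, S) y" if "(u, S) \<in> feasible \<psi> xi chi X T c t x" for u S
  proof -
    have "0 \<le> S * real_of_ereal (legendre_fenchel \<psi> u)"
      using that legendre_fenchel_nonneg[of \<psi> u, OF assms] by (auto simp: feasible_def real_of_ereal_pos)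
    moreover have "m \<le> cond_formula X T kmax y c (t - S) (x + S * u)"
      using that by (intro m) (auto simp: feasible_def)
    ultimately show ?thesis
      by (simp add: path_cost_def)
  qed
  then show ?thesis
    by (intro bdd_belowI2[where m = m]) auto
qed

lemma convex_on_cond_formula:
  "convex_on (decision_space kmax nmax) (\<lambda>y. cond_formula X T kmax y c t x)"
  by (simp add: convex_on_def convex_decision_space cond_formula_combination)

lemma path_cost_combination:
  assumes "a + b = (1::real)"
  shows "path_cost \<psi> X T kmax c t x s (a *\<^sub>R y + b *\<^sub>R z) =
         a * path_cost \<psi> X T kmax c t x s y + b * path_cost \<psi> X T kmax c t x s z"
proof -
  \<comment> \<open>Here \<open>p\<close> and \<open>q\<close> stand for the formula at
    \<open>y\<close> and \<open>z\<close>, and \<open>r\<close> for the running cost, which is free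
    of the coefficients. This constant makes the path cost affine rather than linear, whence
    \<open>a + b = 1\<close>.\<close>
  have "a * (p + r) + b * (q + r) = a * p + b * q + r" for p q r
  proof -
    have "a * r + b * r = r"
      using assms by (simp flip: distrib_right)
    then show ?thesis
      unfolding distrib_left by linarith
  qed
  then show ?thesis
    by (simp add: path_cost_def cond_formula_combination split_beta)
qed

lemma concave_on_path_cost:
  "concave_on (decision_space kmax nmax) (path_cost \<psi> X T kmax c t x s)"
  by (simp add: concave_on_iff convex_decision_space path_cost_combination)

text \<open>Emptiness of the feasible set does not involve \<open>y\<close>, so the difference is
  either \<open>-\<infinity>\<close> for every \<open>y\<close> or real for every \<open>y\<close>:
  the two alternatives of \<open>convex_ereal_on\<close>.\<close>

lemma convex_ereal_on_cond_minus_lax_hopf: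
  assumes psi: "\<psi> 0 = 0" and dom: "(t, x) \<in> cond_dom xi chi X T i"
  shows "convex_ereal_on (decision_space kmax nmax)
    (\<lambda>y. value_cond xi chi X T kmax y i t x - lax_hopf \<psi> (value_cond xi chi X T kmax y j) t x)"
    (is "convex_ereal_on ?Y ?f")
proof (cases "feasible \<psi> xi chi X T j t x = {}")
  case True
  then have "?f y = - \<infinity>" for y
    using dom by (simp add: lax_hopf_value_cond value_cond_def top_ereal_def)
  then show ?thesis
    by (simp add: convex_ereal_on_def)
next
  case False
  let ?h = "path_cost \<psi> X T kmax j t x"
  let ?F = "feasible \<psi> xi chi X T j t x"
  let ?g = "\<lambda>y. cond_formula X T kmax y i t x - (INF s\<in>?F. ?h s y)"
  have "lax_hopf \<psi> (value_cond xi chi X T kmax y j) t x = ereal (INF s\<in>?F. ?h s y)" for y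
    \<comment> \<open>Real and extended infima agree for nonempty families that are bounded
      below.\<close>
    using ereal_Inf'[OF bdd_below_path_cost[of \<psi> X T kmax j t x y xi chi, OF psi]] False
    by (simp add: lax_hopf_value_cond image_image)
  then have "?f y = ereal (?g y)" for y
    using dom by (simp add: value_cond_def)
  moreover have "convex_on ?Y ?g"
    using False
    by (intro convex_on_diff convex_on_cond_formula concave_on_INF concave_on_path_cost
        bdd_below_path_cost psi)
  ultimately show ?thesis
    by (auto simp: convex_ereal_on_def)
qed

theorem proposition3p5:
  fixes v w \<rho>c \<rho>m xi chi X T :: real and kmax nmax :: nat
  assumes "v > 0" and "0 > w"
    and "0 < \<rho>c" and "\<rho>c < \<rho>m"
    and "v * \<rho>c = w * (\<rho>c - \<rho>m)"
    and "xi < chi" and "X > 0" and "T > 0"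
  shows "\<forall>i \<in> conds kmax nmax. \<forall>j \<in> conds kmax nmax. \<forall>(t, x) \<in> cond_dom xi chi X T i.
    (let c = (\<lambda>y. value_cond xi chi X T kmax y i t x);
         M = (\<lambda>y. lax_hopf (triangular_flux v w \<rho>c \<rho>m) (value_cond xi chi X T kmax y j) t x);
         f = (\<lambda>y. c y - M y)
     in (\<forall>y \<in> decision_space kmax nmax. M y \<ge> c y \<longleftrightarrow> f y \<le> 0) \<and>
        convex_ereal_on (decision_space kmax nmax) f)"
proof -
  have "triangular_flux v w \<rho>c \<rho>m 0 = 0"
    using \<open>0 < \<rho>c\<close> by (simp add: triangular_flux_def)
  then have "convex_ereal_on (decision_space kmax nmax) (\<lambda>y. value_cond xi chi X T kmax y i t x -
      lax_hopf (triangular_flux v w \<rho>c \<rho>m) (value_cond xi chi X T kmax y j) t x)"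
    if "(t, x) \<in> cond_dom xi chi X T i" for i j t x
    using that by (rule convex_ereal_on_cond_minus_lax_hopf)
  \<comment> \<open>The condition is finite on its domain, so subtracting an infinite
    \<open>b\<close> is unambiguous and the equivalence also covers
    \<open>b = \<infinity>\<close>.\<close>
  moreover have "value_cond xi chi X T kmax y i t x \<le> b \<longleftrightarrow> value_cond xi chi X T kmax y i t x - b \<le> 0"
    if "(t, x) \<in> cond_dom xi chi X T i" for i t x y b
    using that by (cases b) (auto simp: value_cond_def zero_ereal_def)
  ultimately show ?thesis
    by (simp add: Let_def split_beta)
qed

end
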